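(* For every $f\in\mathcal{F}_H^0$ the area of the image $f(\mathbb{D})$ is less than or equal to $3\pi/2$, and this maximum is attained exactly by the analytic function $z+z^2/2$ and its rotations; that is, $f(\mathbb{D})$ has area $3\pi/2$ if and only if $f(z)=z+e^{i\theta}z^2/2$ for some $\theta\in\mathbb{R}$.
   Context: $\mathbb{D}=\{z\in\mathbb{C}:|z|<1\}$. $\mathcal{F}_H^0$ is the class of all complex-valued harmonic functions $f$ in $\mathbb{D}$ with $f(0)=0$, $f_z(0)=1$, $f_{\bar z}(0)=0$ and $|f_z(z)-1|<1-|f_{\bar z}(z)|$ for all $z\in\mathbb{D}$. A rotation of a function $f$ is a function $z\mapsto e^{-i\theta}f(e^{i\theta}z)$ with $\theta\in\mathbb{R}$. *)

theory Defs
  imports "HOL-Analysis.Analysis"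
begin

definition partial_x :: "(complex \<Rightarrow> complex) \<Rightarrow> complex \<Rightarrow> complex" where
  "partial_x f z = frechet_derivative f (at z) 1"

definition partial_y :: "(complex \<Rightarrow> complex) \<Rightarrow> complex \<Rightarrow> complex" where
  "partial_y f z = frechet_derivative f (at z) \<i>"

(* Wirtinger derivatives f_z and f_{\bar z}, with z = x + i y. *)

definition wirtinger :: "(complex \<Rightarrow> complex) \<Rightarrow> complex \<Rightarrow> complex" where
  "wirtinger f z = (partial_x f z - \<i> * partial_y f z) / 2"

definition wirtinger_bar :: "(complex \<Rightarrow> complex) \<Rightarrow> complex \<Rightarrow> complex" where
  "wirtinger_bar f z = (partial_x f z + \<i> * partial_y f z) / 2"

(* Twice continuously differentiable in the real sense.  Differentiability of f and of its
   first partials is at every point z (two-sided), so S is meant to be open. *)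

definition C2_on :: "(complex \<Rightarrow> complex) \<Rightarrow> complex set \<Rightarrow> bool" where
  "C2_on f S \<longleftrightarrow>
     (\<forall>z\<in>S. f differentiable (at z)) \<and>
     (\<forall>z\<in>S. partial_x f differentiable (at z)) \<and>
     (\<forall>z\<in>S. partial_y f differentiable (at z)) \<and>
     continuous_on S (partial_x (partial_x f)) \<and>
     continuous_on S (partial_y (partial_x f)) \<and>
     continuous_on S (partial_x (partial_y f)) \<and>
     continuous_on S (partial_y (partial_y f))"

definition harmonic_on :: "(complex \<Rightarrow> complex) \<Rightarrow> complex set \<Rightarrow> bool" where
  "harmonic_on f S \<longleftrightarrow>
     C2_on f S \<and> (\<forall>z\<in>S. partial_x (partial_x f) z + partial_y (partial_y f) z = 0)"

(* Only the values of a member on the unit disk matter. *)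

definition FH0 :: "(complex \<Rightarrow> complex) set" where
  "FH0 = {f. harmonic_on f (ball 0 1) \<and>
             f 0 = 0 \<and> wirtinger f 0 = 1 \<and> wirtinger_bar f 0 = 0 \<and>
             (\<forall>z\<in>ball 0 1. cmod (wirtinger f z - 1) < 1 - cmod (wirtinger_bar f z))}"

definition rotation :: "real \<Rightarrow> (complex \<Rightarrow> complex) \<Rightarrow> complex \<Rightarrow> complex" where
  "rotation \<theta> f z = exp (- \<i> * of_real \<theta>) * f (exp (\<i> * of_real \<theta>) * z)"

(* Lebesgue area, with values in the extended nonnegative reals.  The image of the disk under a
   continuous function is sigma-compact, hence Borel, so the convention that emeasure is 0 on
   non-measurable sets plays no role there. *)

definition area :: "complex set \<Rightarrow> ennreal" where
  "area A = emeasure lebesgue A"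

end

theory Submission
  imports Defs "HOL-Complex_Analysis.Conformal_Mappings"
begin

text \<open>
  Put \<open>\<phi> = f_z - 1\<close> and let \<open>\<psi>\<close> be the conjugate of \<open>f_{\bar z}\<close>.  Both are holomorphic because
  \<open>f\<close> is harmonic (\<open>harmonic_wirtinger_holomorphic\<close>), both vanish at 0, and \<open>|\<phi>| + |\<psi>| < 1\<close>.
  Applying the Schwarz lemma to \<open>\<phi> + u \<psi>\<close> for all unimodular \<open>u\<close> improves this to
  \<open>|\<phi>| + |\<psi>| \<le> |z|\<close> (\<open>Schwarz_norm_sum\<close>).

  The area of the image is at most the integral of the Jacobian over the disk,
  \<open>\<integral> |1 + \<phi>|\<^sup>2 - |\<psi>|\<^sup>2 = \<integral> 1 + 2 \<integral> Re \<phi> + \<integral> (|\<phi>|\<^sup>2 - |\<psi>|\<^sup>2)\<close>.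
  The first integral is \<open>\<pi>\<close>, the second is 0 by the mean value property
  (\<open>integral_disk_Re_holomorphic\<close>), and the third is at most \<open>\<integral> |z|\<^sup>2 = \<pi> / 2\<close>.  That is the bound.

  If the area is maximal, then \<open>|z|\<^sup>2 - |\<phi>|\<^sup>2 + |\<psi>|\<^sup>2\<close>, which is continuous and nonnegative, has
  integral 0 and so vanishes.  By the equality case of the Schwarz lemma \<open>\<phi> z = \<alpha> z\<close> with
  \<open>|\<alpha>| = 1\<close>, which forces \<open>\<psi> = 0\<close> and \<open>f z = z + \<alpha> z\<^sup>2 / 2\<close> (\<open>zero_integral_defect\<close>,
  \<open>FH0_area_max_imp\<close>).  Conversely this polynomial is injective on the disk, so that its image has
  precisely the area given by the Jacobian (\<open>extremal_area\<close>).

  Areas and changes of variables in \<open>complex\<close> are treated by identifying it with \<open>real^2\<close>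
  through a linear map that matches the coordinate axes and hence preserves Lebesgue measure.
\<close>

section \<open>Linear maps matching coordinate bases preserve Lebesgue measure\<close>

text \<open>
  The preimage of a box under such a map is a box with the same side lengths, and boxes determine
  Lebesgue measure.  The only instances used below are the two identifications of \<open>complex\<close> with
  \<open>real^2\<close>, which carry the change of variables theorems from vectors to complex numbers.
\<close>

lemma Basis_bijection_lborel:
  fixes T :: "'a::euclidean_space \<Rightarrow> 'b::euclidean_space"
  assumes lin: "linear T" and bij: "bij_betw T Basis Basis"
  shows "distr lborel borel T = lborel"
proof (rule lborel_eqI[symmetric])
  have inner: "T x \<bullet> T b = x \<bullet> b" if b: "b \<in> Basis" for x b
  proof -
    have "T x = T (\<Sum>j\<in>Basis. (x \<bullet> j) *\<^sub>R j)"
      by (simp add: euclidean_representation)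
    also have "\<dots> = (\<Sum>j\<in>Basis. (x \<bullet> j) *\<^sub>R T j)"
      by (simp add: linear_sum[OF lin] linear_scale[OF lin])
    finally have "T x \<bullet> T b = (\<Sum>j\<in>Basis. (x \<bullet> j) * (T j \<bullet> T b))"
      by (simp add: inner_sum_left)
    also have "\<dots> = (\<Sum>j\<in>Basis. (x \<bullet> j) * (if j = b then 1 else 0))"
    proof (rule sum.cong[OF refl])
      fix j :: 'a assume j: "j \<in> Basis"
      then have "T j \<in> Basis" "T b \<in> Basis" "T j = T b \<longleftrightarrow> j = b"
        using bij b by (auto simp: bij_betw_def inj_on_def)
      then show "(x \<bullet> j) * (T j \<bullet> T b) = (x \<bullet> j) * (if j = b then 1 else 0)"
        by (simp add: inner_Basis)
    qed
    also have "\<dots> = x \<bullet> b"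
      using b by (simp add: if_distrib cong: if_cong)
    finally show ?thesis .
  qed
  have meas: "T \<in> borel_measurable borel"
    using lin by (intro borel_measurable_continuous_onI linear_continuous_on linear_conv_bounded_linear[THEN iffD1])
  have img: "T ` Basis = Basis"
    using bij by (simp add: bij_betw_def)
  fix l u :: 'b assume le: "\<And>b. b \<in> Basis \<Longrightarrow> l \<bullet> b \<le> u \<bullet> b"
  \<comment> \<open>\<open>c\<close> is the adjoint, hence the inverse, of \<open>T\<close>; it supplies the corners of the preimage box.\<close>
  define c :: "'b \<Rightarrow> 'a" where "c = (\<lambda>y. \<Sum>b\<in>Basis. (y \<bullet> T b) *\<^sub>R b)"
  have c: "c y \<bullet> b = y \<bullet> T b" if "b \<in> Basis" for y b
    using that by (simp add: c_def inner_sum_left inner_Basis if_distrib cong: if_cong)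
  have "T -` box l u = box (c l) (c u)"
  proof (rule set_eqI)
    fix x
    have "x \<in> T -` box l u \<longleftrightarrow> (\<forall>j\<in>T ` Basis. l \<bullet> j < T x \<bullet> j \<and> T x \<bullet> j < u \<bullet> j)"
      by (simp add: box_def img)
    also have "\<dots> \<longleftrightarrow> x \<in> box (c l) (c u)"
      by (simp add: box_def c inner)
    finally show "x \<in> T -` box l u \<longleftrightarrow> x \<in> box (c l) (c u)" .
  qed
  moreover have "emeasure lborel (box (c l) (c u)) = (\<Prod>b\<in>Basis. (c u - c l) \<bullet> b)"
  proof (rule emeasure_lborel_box)
    fix b :: 'a assume "b \<in> Basis"
    then show "c l \<bullet> b \<le> c u \<bullet> b"
      using le[of "T b"] img by (auto simp: c)
  qed
  moreover have "(\<Prod>b\<in>Basis. (c u - c l) \<bullet> b) = (\<Prod>b\<in>Basis. (u - l) \<bullet> T b)"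
    by (intro prod.cong) (auto simp: c inner_diff_left)
  moreover have "\<dots> = (\<Prod>b\<in>Basis. (u - l) \<bullet> b)"
    using prod.reindex_bij_betw[OF bij, of "\<lambda>b. (u - l) \<bullet> b"] by simp
  ultimately show "emeasure (distr lborel borel T) (box l u) = (\<Prod>b\<in>Basis. (u - l) \<bullet> b)"
    using meas by (simp add: emeasure_distr)
qed simp

lemma
  fixes T :: "'a::euclidean_space \<Rightarrow> 'b::euclidean_space"
  assumes lin: "linear T" and bij: "bij_betw T Basis Basis"
  shows Basis_bijection_measurable: "T \<in> lebesgue \<rightarrow>\<^sub>M lebesgue"
    and Basis_bijection_lebesgue: "distr lebesgue lebesgue T = lebesgue"
proof -
  have T[measurable]: "T \<in> borel \<rightarrow>\<^sub>M borel"
    using lin by (intro borel_measurable_continuous_onI linear_continuous_on linear_conv_bounded_linear[THEN iffD1])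
  have "distr lebesgue lborel T = distr lborel lborel T"
    by (intro distr_completion) simp
  then have d: "distr lebesgue lborel T = lborel"
    using Basis_bijection_lborel[OF assms] by (simp cong: distr_cong)
  show "T \<in> lebesgue \<rightarrow>\<^sub>M lebesgue"
    by (simp add: completion.measurable_completion2 d measurable_completion)
  show "distr lebesgue lebesgue T = lebesgue"
    using completion.completion_distr_eq[of T "lborel::'a measure" "lborel::'b measure"] 
    by (simp add: d measurable_completion)
qed

text \<open>
  The converse is this lemma for the inverse map, which is how \<open>plane_integral\<close> combines the two
  directions.
\<close>

lemma Basis_bijection_absolutely_integrable:
  fixes T :: "'a::euclidean_space \<Rightarrow> 'b::euclidean_space" and f :: "'b \<Rightarrow> 'c::euclidean_space"
  assumes lin: "linear T" and bij: "bij_betw T Basis Basis" and f: "f absolutely_integrable_on T ` S"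
    and inj: "inj T"
  shows "(\<lambda>x. f (T x)) absolutely_integrable_on S" "integral S (\<lambda>x. f (T x)) = integral (T ` S) f"
proof -
  have eq: "indicat_real (T ` S) (T x) *\<^sub>R f (T x) = indicator S x *\<^sub>R f (T x)" for x
    using inj by (auto simp: indicator_def inj_def)
  have i: "integrable (distr lebesgue lebesgue T) (\<lambda>y. indicat_real (T ` S) y *\<^sub>R f y)"
    using f by (simp add: Basis_bijection_lebesgue[OF lin bij] set_integrable_def)
  show 1: "(\<lambda>x. f (T x)) absolutely_integrable_on S"
    using integrable_distr[OF Basis_bijection_measurable[OF lin bij] i]
    by (simp add: set_integrable_def eq)
  have "integral\<^sup>L lebesgue (\<lambda>y. indicat_real (T ` S) y *\<^sub>R f y) =
     integral\<^sup>L (distr lebesgue lebesgue T) (\<lambda>y. indicat_real (T ` S) y *\<^sub>R f y)"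
    by (simp add: Basis_bijection_lebesgue[OF lin bij])
  also have "\<dots> = integral\<^sup>L lebesgue (\<lambda>x. indicator S x *\<^sub>R f (T x))"
    using i by (subst integral_distr[OF Basis_bijection_measurable[OF lin bij]])
      (auto simp: eq dest: borel_measurable_integrable)
  finally show "integral S (\<lambda>x. f (T x)) = integral (T ` S) f"
    using f 1 by (simp add: set_lebesgue_integral_eq_integral(2)[symmetric] set_lebesgue_integral_def)
qed

section \<open>Change of variables in the complex plane\<close>

definition to_plane :: "complex \<Rightarrow> real^2" where
  "to_plane z = (\<chi> i. if i = 1 then Re z else Im z)"

definition of_plane :: "real^2 \<Rightarrow> complex" where
  "of_plane v = Complex (v $ 1) (v $ 2)"

lemma of_to_plane [simp]: "of_plane (to_plane z) = z"
  by (simp add: to_plane_def of_plane_def complex_eq_iff)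

lemma to_of_plane [simp]: "to_plane (of_plane v) = v"
  by (simp add: to_plane_def of_plane_def vec_eq_iff forall_2)

lemma linear_to_plane: "linear to_plane"
  by (auto intro!: linearI simp: to_plane_def vec_eq_iff)

lemma linear_of_plane: "linear of_plane"
  by (auto intro!: linearI simp: of_plane_def complex_eq_iff)

lemma Basis_plane: "(Basis :: (real^2) set) = {axis 1 1, axis 2 1}"
  by (auto simp: Basis_vec_def UNIV_2)

lemma plane_Basis: "to_plane 1 = axis 1 1" "to_plane \<i> = axis 2 1"
  "of_plane (axis 1 1) = 1" "of_plane (axis 2 1) = \<i>"
  by (auto simp: to_plane_def of_plane_def axis_def vec_eq_iff forall_2 complex_eq_iff)

lemma bij_to_plane: "bij_betw to_plane Basis Basis"
  by (rule bij_betw_byWitness[where f' = of_plane])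
     (auto simp: Basis_plane Basis_complex_def plane_Basis)

lemma bij_of_plane: "bij_betw of_plane Basis Basis"
  by (rule bij_betw_byWitness[where f' = to_plane])
     (auto simp: Basis_plane Basis_complex_def plane_Basis)

lemma inj_to_plane: "inj to_plane" and inj_of_plane: "inj of_plane"
  by (metis injI of_to_plane, metis injI to_of_plane)

lemma to_plane_image: "to_plane ` S = of_plane -` S"
  by force

lemma plane_sets: "to_plane ` S \<in> sets lebesgue \<longleftrightarrow> S \<in> sets lebesgue"
proof
  assume "S \<in> sets lebesgue"
  from measurable_sets[OF Basis_bijection_measurable[OF linear_of_plane bij_of_plane] this]
  show "to_plane ` S \<in> sets lebesgue"
    by (simp add: to_plane_image)
next
  assume "to_plane ` S \<in> sets lebesgue"
  from measurable_sets[OF Basis_bijection_measurable[OF linear_to_plane bij_to_plane] this]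
  show "S \<in> sets lebesgue"
    using inj_to_plane by (simp add: inj_vimage_image_eq)
qed

lemma plane_emeasure:
  assumes "S \<in> sets lebesgue"
  shows "emeasure lebesgue (to_plane ` S) = emeasure lebesgue S"
proof -
  have "emeasure (distr lebesgue lebesgue to_plane) (to_plane ` S) = emeasure lebesgue S"
    using assms inj_to_plane
    by (subst emeasure_distr[OF Basis_bijection_measurable[OF linear_to_plane bij_to_plane]])
       (auto simp: plane_sets inj_vimage_image_eq)
  then show ?thesis
    by (simp add: Basis_bijection_lebesgue[OF linear_to_plane bij_to_plane])
qed

lemma plane_integral:
  fixes f :: "real^2 \<Rightarrow> 'c::euclidean_space"
  shows "f absolutely_integrable_on to_plane ` S \<and> integral (to_plane ` S) f = m \<longleftrightarrow>
    (\<lambda>z. f (to_plane z)) absolutely_integrable_on S \<and> integral S (\<lambda>z. f (to_plane z)) = m"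
proof -
  have *: "(\<lambda>z. f (to_plane z)) absolutely_integrable_on S \<Longrightarrow> f absolutely_integrable_on to_plane ` S"
    using Basis_bijection_absolutely_integrable(1)[OF linear_of_plane bij_of_plane _ inj_of_plane,
        where f = "\<lambda>z. f (to_plane z)" and S = "to_plane ` S"]
    by (simp add: image_image)
  show ?thesis
    using * Basis_bijection_absolutely_integrable[OF linear_to_plane bij_to_plane _ inj_to_plane, where f = f and S = S]
    by metis
qed

text \<open>
  The absolute value of the determinant of the real-linear map \<open>L\<close>, whose matrix has the
  columns \<open>L 1\<close> and \<open>L \<i>\<close>.
\<close>

definition area_factor :: "(complex \<Rightarrow> complex) \<Rightarrow> real" where
  "area_factor L = \<bar>Im (cnj (L 1) * L \<i>)\<bar>"

lemma det_plane: "\<bar>det (matrix (to_plane \<circ> L \<circ> of_plane))\<bar> = area_factor L"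
  unfolding area_factor_def
  by (simp add: det_2 matrix_def plane_Basis to_plane_def algebra_simps)

lemma plane_derivative:
  assumes "(g has_derivative g') (at z within S)"
  shows "((to_plane \<circ> g \<circ> of_plane) has_derivative (to_plane \<circ> g' \<circ> of_plane)) (at (to_plane z) within to_plane ` S)"
proof -
  have "(of_plane has_derivative of_plane) (at (to_plane z) within to_plane ` S)"
    by (simp add: linear_imp_has_derivative linear_of_plane)
  moreover have "(g has_derivative g') (at (of_plane (to_plane z)) within of_plane ` to_plane ` S)"
    using assms by (simp add: image_image)
  ultimately have "((g \<circ> of_plane) has_derivative (g' \<circ> of_plane)) (at (to_plane z) within to_plane ` S)"
    by (rule diff_chain_within)
  moreover have "(to_plane has_derivative to_plane) (at ((g \<circ> of_plane) (to_plane z)) within (g \<circ> of_plane) ` to_plane ` S)"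
    by (simp add: linear_imp_has_derivative linear_to_plane)
  ultimately show ?thesis
    unfolding comp_assoc by (rule diff_chain_within)
qed

lemma plane_conj_image: "(to_plane \<circ> g \<circ> of_plane) ` to_plane ` S = to_plane ` g ` S"
  by (simp only: image_image comp_def of_to_plane)

text \<open>
  Points covered several times count once on the left and with multiplicity on the right.
\<close>

lemma complex_area_le:
  assumes S: "S \<in> sets lebesgue"
    and g: "\<And>z. z \<in> S \<Longrightarrow> (g has_derivative g' z) (at z within S)"
    and int: "(\<lambda>z. area_factor (g' z)) absolutely_integrable_on S"
  shows "g ` S \<in> sets lebesgue"
    and "emeasure lebesgue (g ` S) \<le> ennreal (integral S (\<lambda>z. area_factor (g' z)))"
proof -
  define G where "G = to_plane \<circ> g \<circ> of_plane"
  define G' where "G' = (\<lambda>v. to_plane \<circ> g' (of_plane v) \<circ> of_plane)"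
  have S': "to_plane ` S \<in> sets lebesgue"
    using S by (simp add: plane_sets)
  have der: "(G has_derivative G' v) (at v within to_plane ` S)" if "v \<in> to_plane ` S" for v
    using that plane_derivative[OF g] by (auto simp: G_def G'_def)
  have i: "(\<lambda>v. \<bar>det (matrix (G' v))\<bar>) absolutely_integrable_on to_plane ` S"
    "integral (to_plane ` S) (\<lambda>v. \<bar>det (matrix (G' v))\<bar>) = integral S (\<lambda>z. area_factor (g' z))"
    using plane_integral[where f = "\<lambda>v. \<bar>det (matrix (G' v))\<bar>" and S = S] int by (auto simp: G'_def det_plane)
  note i' = set_lebesgue_integral_eq_integral(1)[OF i(1)]
  have l: "G ` to_plane ` S \<in> lmeasurable"
    by (rule measurable_differentiable_image[OF S' der i'])
  have m: "measure lebesgue (G ` to_plane ` S) \<le> integral S (\<lambda>z. area_factor (g' z))"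
    using measure_differentiable_image[OF S' der i'] by (simp add: i(2))
  have G: "G ` to_plane ` S = to_plane ` g ` S"
    unfolding G_def by (rule plane_conj_image)
  show 1: "g ` S \<in> sets lebesgue"
    using l by (simp add: G plane_sets fmeasurable_def)
  show "emeasure lebesgue (g ` S) \<le> ennreal (integral S (\<lambda>z. area_factor (g' z)))"
    using l m by (simp add: G emeasure_eq_measure2 ennreal_leI flip: plane_emeasure[OF 1])
qed

text \<open>
  With \<open>f = 1\<close> this gives the exact area of an injective image; rotations give the symmetry of
  the disk, and the radial map of \<open>integral_disk_norm_square\<close> replaces polar coordinates.
\<close>

lemma complex_change_of_variables:
  fixes f :: "complex \<Rightarrow> real"
  assumes S: "S \<in> sets lebesgue"
    and g: "\<And>z. z \<in> S \<Longrightarrow> (g has_derivative g' z) (at z within S)"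
    and inj: "inj_on g S"
  shows "(\<lambda>z. area_factor (g' z) * f (g z)) absolutely_integrable_on S \<and>
      integral S (\<lambda>z. area_factor (g' z) * f (g z)) = m \<longleftrightarrow>
    f absolutely_integrable_on g ` S \<and> integral (g ` S) f = m"
proof -
  define G where "G = to_plane \<circ> g \<circ> of_plane"
  define G' where "G' = (\<lambda>v. to_plane \<circ> g' (of_plane v) \<circ> of_plane)"
  \<comment> \<open>Change of variables in \<open>real^2\<close> concerns vector-valued integrands; \<open>real^1\<close> stands for the reals.\<close>
  define F :: "real^2 \<Rightarrow> real^1" where "F = (\<lambda>v. vec (f (of_plane v)))"
  have S': "to_plane ` S \<in> sets lebesgue"
    using S by (simp add: plane_sets)
  have der: "(G has_derivative G' v) (at v within to_plane ` S)" if "v \<in> to_plane ` S" for v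
    using that plane_derivative[OF g] by (auto simp: G_def G'_def)
  have injG: "inj_on G (to_plane ` S)"
    using inj by (auto simp: G_def inj_on_def inj_eq[OF inj_to_plane])
  have G: "G ` to_plane ` S = to_plane ` g ` S"
    unfolding G_def by (rule plane_conj_image)
  have vec1: "((\<lambda>x. vec (h x) :: real^1) absolutely_integrable_on A \<and> integral A (\<lambda>x. vec (h x) :: real^1) = vec m)
     \<longleftrightarrow> (h absolutely_integrable_on A \<and> integral A h = m)" for h :: "real^2 \<Rightarrow> real" and A 
    by (auto simp: absolutely_integrable_on_1_iff integral_on_1_eq)
  have "(\<lambda>z. area_factor (g' z) * f (g z)) absolutely_integrable_on S \<and>
      integral S (\<lambda>z. area_factor (g' z) * f (g z)) = m \<longleftrightarrow>
    (\<lambda>v. \<bar>det (matrix (G' v))\<bar> *\<^sub>R F (G v)) absolutely_integrable_on to_plane ` S \<and>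
      integral (to_plane ` S) (\<lambda>v. \<bar>det (matrix (G' v))\<bar> *\<^sub>R F (G v)) = vec m"
    using vec1[where h = "\<lambda>v. \<bar>det (matrix (G' v))\<bar> * f (of_plane (G v))" and A = "to_plane ` S"]
      plane_integral[where f = "\<lambda>v. \<bar>det (matrix (G' v))\<bar> * f (of_plane (G v))" and S = S and m = m]
    by (simp add: F_def vec_cmul G'_def G_def det_plane scaleR_vec_def vec_def)
  also have "\<dots> \<longleftrightarrow> F absolutely_integrable_on to_plane ` g ` S \<and> integral (to_plane ` g ` S) F = vec m"
    using has_absolute_integral_change_of_variables[OF S' der injG, of F "vec m"] by (simp add: G)
  also have "\<dots> \<longleftrightarrow> f absolutely_integrable_on g ` S \<and> integral (g ` S) f = m"
    using vec1[where h = "\<lambda>v. f (of_plane v)" and A = "to_plane ` g ` S"]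
      plane_integral[where f = "\<lambda>v. f (of_plane v)" and S = "g ` S" and m = m]
    by (simp add: F_def)
  finally show ?thesis .
qed

section \<open>Wirtinger derivatives of harmonic functions\<close>

text \<open>
  Fix \<open>t\<close> and follow the difference along \<open>v\<close> as the base point moves in direction \<open>u\<close>: the
  derivative of \<open>s \<mapsto> f (z + s u + t v) - f (z + s u)\<close> is an increment of \<open>f' _ u\<close>, which
  differentiability at the single point \<open>z\<close> approximates by \<open>t P v\<close> up to \<open>o(t)\<close>.  The mean
  value inequality over \<open>0 \<le> s \<le> t\<close> turns this into an error \<open>o(t\<^sup>2)\<close>.
\<close>

lemma second_difference_estimate:
  fixes f :: "'a::real_normed_vector \<Rightarrow> 'b::real_normed_vector"
  assumes S: "open S" "z \<in> S"
    and f: "\<And>x. x \<in> S \<Longrightarrow> (f has_derivative f' x) (at x)"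
    and P: "((\<lambda>x. f' x u) has_derivative P) (at z)"
  shows "((\<lambda>t. (f (z + t *\<^sub>R u + t *\<^sub>R v) - f (z + t *\<^sub>R u) - f (z + t *\<^sub>R v) + f z) /\<^sub>R t\<^sup>2) \<longlongrightarrow> P v) (at_right 0)"
proof (rule tendstoI)
  fix e :: real assume e: "e > 0"
  \<comment> \<open>The displacements \<open>s u + t v\<close> and \<open>s u\<close> have total length at most \<open>t K\<close>, so that the final
      error is at most \<open>\<eta> K t\<^sup>2 = (e / 2) t\<^sup>2\<close>.\<close>
  define K where "K = 2 * norm u + norm v + 1"
  have K: "K > 0" by (auto simp: K_def intro: add_nonneg_pos)
  define \<eta> where "\<eta> = e / (2 * K)"
  have \<eta>: "\<eta> > 0" using e K by (simp add: \<eta>_def)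
  obtain d1 where d1: "d1 > 0" "\<And>y. norm (y - z) < d1 \<Longrightarrow>
      norm (f' y u - f' z u - P (y - z)) \<le> \<eta> * norm (y - z)"
    using P \<eta> unfolding has_derivative_at_alt by blast
  obtain d2 where d2: "d2 > 0" "ball z d2 \<subseteq> S"
    using S by (meson open_contains_ball)
  interpret P: bounded_linear P using P by (rule has_derivative_bounded_linear)
  define d where "d = min d1 d2 / K"
  have d: "d > 0" using d1 d2 K by (simp add: d_def)
  have est: "norm ((f (z + t *\<^sub>R u + t *\<^sub>R v) - f (z + t *\<^sub>R u) - f (z + t *\<^sub>R v) + f z) /\<^sub>R t\<^sup>2 - P v) < e"
    if t: "0 < t" "t < d" for t
  proof -
    have tK: "t * K < min d1 d2"
      using t K by (simp add: d_def field_simps)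
    have near: "norm (s *\<^sub>R u + r *\<^sub>R v) < min d1 d2" if "0 \<le> s" "s \<le> t" "0 \<le> r" "r \<le> t" for s r
    proof -
      have "norm (s *\<^sub>R u + r *\<^sub>R v) \<le> s * norm u + r * norm v"
        using that norm_triangle_ineq[of "s *\<^sub>R u" "r *\<^sub>R v"] by simp
      also have "\<dots> \<le> t * norm u + t * norm v"
        using that by (intro add_mono mult_right_mono) auto
      also have "\<dots> \<le> t * K"
        using t by (simp add: K_def algebra_simps)
      finally show ?thesis using tK by linarith
    qed
    have inS: "z + s *\<^sub>R u + r *\<^sub>R v \<in> S" if "0 \<le> s" "s \<le> t" "0 \<le> r" "r \<le> t" for s r
    proof -
      have "dist z (z + s *\<^sub>R u + r *\<^sub>R v) = norm (s *\<^sub>R u + r *\<^sub>R v)"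
        by (metis add.assoc dist_add_cancel dist_norm norm_minus_commute diff_zero add.right_neutral)
      then show ?thesis
        using near[OF that] d2 by auto
    qed
    define g where "g = (\<lambda>s. f (z + s *\<^sub>R u + t *\<^sub>R v) - f (z + s *\<^sub>R u) - (s * t) *\<^sub>R P v)"
    define g' where "g' = (\<lambda>s. f' (z + s *\<^sub>R u + t *\<^sub>R v) u - f' (z + s *\<^sub>R u) u - t *\<^sub>R P v)"
    have der: "(g has_derivative (\<lambda>h. h *\<^sub>R g' s)) (at s within {0..t})" if s: "s \<in> {0..t}" for s
    proof -
      have A: "((\<lambda>s. f (z + s *\<^sub>R u + w)) has_derivative (\<lambda>h. h *\<^sub>R f' (z + s *\<^sub>R u + w) u)) (at s within {0..t})"
        if "z + s *\<^sub>R u + w \<in> S" for w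
      proof -
        have 1: "((\<lambda>s. z + s *\<^sub>R u + w) has_derivative (\<lambda>h. h *\<^sub>R u)) (at s within {0..t})"
          by (auto intro!: derivative_eq_intros)
        have lin: "linear (f' (z + s *\<^sub>R u + w))"
          using f[OF that] by (rule has_derivative_linear)
        show ?thesis
          using has_derivative_compose[OF 1 f[OF that]] by (simp add: linear_scale[OF lin])
      qed
      show ?thesis
        unfolding g_def g'_def
        using A[of "t *\<^sub>R v"] A[of 0] inS[of s t] inS[of s 0] s t
        by (auto intro!: derivative_eq_intros simp: algebra_simps)
    qed
    have bound: "norm (g' s) \<le> \<eta> * K * t" if s: "s \<in> {0..t}" for s
    proof -
      have 1: "norm (f' (z + s *\<^sub>R u + t *\<^sub>R v) u - f' z u - P (s *\<^sub>R u + t *\<^sub>R v)) \<le> \<eta> * norm (s *\<^sub>R u + t *\<^sub>R v)"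
        using d1(2)[of "z + s *\<^sub>R u + t *\<^sub>R v"] near[of s t] s t by (simp add: add.assoc)
      have 2: "norm (f' (z + s *\<^sub>R u) u - f' z u - P (s *\<^sub>R u)) \<le> \<eta> * norm (s *\<^sub>R u)"
        using d1(2)[of "z + s *\<^sub>R u"] near[of s 0] s t by simp
      have "g' s = (f' (z + s *\<^sub>R u + t *\<^sub>R v) u - f' z u - P (s *\<^sub>R u + t *\<^sub>R v)) -
          (f' (z + s *\<^sub>R u) u - f' z u - P (s *\<^sub>R u))"
        by (simp add: g'_def P.add P.scaleR)
      then have "norm (g' s) \<le> \<eta> * norm (s *\<^sub>R u + t *\<^sub>R v) + \<eta> * norm (s *\<^sub>R u)"
        using norm_triangle_le_diff[OF add_mono[OF 1 2]] by simp
      also have "\<dots> \<le> \<eta> * (t * norm u + t * norm v + t * norm u)"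
      proof -
        have su: "norm (s *\<^sub>R u) \<le> t * norm u"
          using s by (simp add: mult_right_mono)
        have "norm (s *\<^sub>R u + t *\<^sub>R v) \<le> norm (s *\<^sub>R u) + t * norm v"
          using t norm_triangle_ineq[of "s *\<^sub>R u" "t *\<^sub>R v"] by simp
        then have "norm (s *\<^sub>R u + t *\<^sub>R v) + norm (s *\<^sub>R u) \<le> t * norm u + t * norm v + t * norm u"
          using su by linarith
        then show ?thesis using \<eta> by (simp add: distrib_left[symmetric])
      qed
      also have "\<dots> \<le> \<eta> * K * t"
        using \<eta> t by (simp add: K_def algebra_simps)
      finally show ?thesis .
    qed
    have "norm (g t - g 0) \<le> \<eta> * K * t * norm (t - 0)"
    proof (rule differentiable_bound[OF _ der])
      fix s assume "s \<in> {0..t}"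
      then show "onorm (\<lambda>h. h *\<^sub>R g' s) \<le> \<eta> * K * t"
        using bound[of s] by (intro onorm_le) (metis mult.commute mult_right_mono norm_ge_zero norm_scaleR real_norm_def)
    qed (use t in auto)
    also have "\<dots> = e / 2 * t\<^sup>2"
      using K t by (simp add: \<eta>_def power2_eq_square)
    finally have le: "norm (g t - g 0) \<le> e / 2 * t\<^sup>2" .
    have "(f (z + t *\<^sub>R u + t *\<^sub>R v) - f (z + t *\<^sub>R u) - f (z + t *\<^sub>R v) + f z) /\<^sub>R t\<^sup>2 - P v = (g t - g 0) /\<^sub>R t\<^sup>2"
      using t by (simp add: g_def power2_eq_square algebra_simps)
    then have "norm ((f (z + t *\<^sub>R u + t *\<^sub>R v) - f (z + t *\<^sub>R u) - f (z + t *\<^sub>R v) + f z) /\<^sub>R t\<^sup>2 - P v) = norm (g t - g 0) / t\<^sup>2"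
      by (simp add: divide_inverse mult.commute)
    also have "\<dots> \<le> e / 2"
      using le t by (simp add: pos_divide_le_eq)
    finally show ?thesis using e by linarith
  qed
  show "\<forall>\<^sub>F t in at_right 0. dist ((f (z + t *\<^sub>R u + t *\<^sub>R v) - f (z + t *\<^sub>R u) - f (z + t *\<^sub>R v) + f z) /\<^sub>R t\<^sup>2) (P v) < e"
    unfolding eventually_at_right_field dist_norm using d est by (intro exI[of _ d]) auto
qed

text \<open>
  The second difference is symmetric in the two directions, and it computes both mixed
  derivatives.
\<close>

lemma symmetric_second_derivative:
  fixes f :: "'a::real_normed_vector \<Rightarrow> 'b::real_normed_vector"
  assumes S: "open S" "z \<in> S"
    and f: "\<And>x. x \<in> S \<Longrightarrow> (f has_derivative f' x) (at x)"
    and P: "((\<lambda>x. f' x u) has_derivative P) (at z)"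
    and Q: "((\<lambda>x. f' x v) has_derivative Q) (at z)"
  shows "P v = Q u"
proof -
  have "((\<lambda>t. (f (z + t *\<^sub>R u + t *\<^sub>R v) - f (z + t *\<^sub>R u) - f (z + t *\<^sub>R v) + f z) /\<^sub>R t\<^sup>2) \<longlongrightarrow> Q u) (at_right 0)"
    using second_difference_estimate[OF S f Q, of u] by (simp add: algebra_simps)
  from tendsto_unique[OF trivial_limit_at_right_real second_difference_estimate[OF S f P, of v] this]
  show ?thesis .
qed

lemma real_linear_complex:
  fixes L :: "complex \<Rightarrow> complex"
  assumes "linear L"
  shows "L h = Re h *\<^sub>R L 1 + Im h *\<^sub>R L \<i>"
proof -
  have "L (Re h *\<^sub>R 1 + Im h *\<^sub>R \<i>) = Re h *\<^sub>R L 1 + Im h *\<^sub>R L \<i>"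
    by (simp only: linear_add[OF assms] linear_scale[OF assms])
  moreover have "Re h *\<^sub>R 1 + Im h *\<^sub>R \<i> = h"
    by (simp add: complex_eq_iff)
  ultimately show ?thesis by simp
qed

lemma complex_linear_has_field_derivative:
  assumes F: "(F has_derivative L) (at z)" and L: "L \<i> = \<i> * L 1"
  shows "(F has_field_derivative L 1) (at z)"
proof -
  have lin: "linear L" using F by (rule has_derivative_linear)
  have "L = (*) (L 1)"
  proof
    fix h
    have "L h = L 1 * (of_real (Re h) + \<i> * of_real (Im h))"
      unfolding real_linear_complex[OF lin, of h] L by (simp add: scaleR_conv_of_real algebra_simps)
    then show "L h = L 1 * h" by (simp flip: complex_eq)
  qed
  with F show ?thesis by (simp add: has_field_derivative_def)
qed

lemma has_derivative_wirtinger: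
  assumes "f differentiable (at z)"
  shows "(f has_derivative (\<lambda>h. wirtinger f z * h + wirtinger_bar f z * cnj h)) (at z)"
proof -
  define L where "L = frechet_derivative f (at z)"
  have L: "(f has_derivative L) (at z)"
    using assms by (simp add: L_def frechet_derivative_works)
  then have lin: "linear L" by (rule has_derivative_linear)
  have ii: "\<i> * (w * \<i>) = - w" for w
    by (simp add: complex_eq_iff)
  have "L = (\<lambda>h. wirtinger f z * h + wirtinger_bar f z * cnj h)"
  proof
    fix h
    have "wirtinger f z * h + wirtinger_bar f z * cnj h =
        (h + cnj h) / 2 * L 1 - \<i> * (h - cnj h) / 2 * L \<i>"
      by (simp add: wirtinger_def wirtinger_bar_def partial_x_def partial_y_def L_def[symmetric] field_simps)
    also have "\<dots> = Re h *\<^sub>R L 1 + Im h *\<^sub>R L \<i>"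
      unfolding complex_add_cnj complex_diff_cnj by (simp add: scaleR_conv_of_real ii)
    finally show "L h = wirtinger f z * h + wirtinger_bar f z * cnj h"
      using real_linear_complex[OF lin, of h] by simp
  qed
  with L show ?thesis by metis
qed

text \<open>
  With \<open>P\<close> and \<open>Q\<close> the derivatives of \<open>f_x\<close> and \<open>f_y\<close>, the Cauchy-Riemann equations for
  \<open>f_z\<close> and for the conjugate of \<open>f_{\bar z}\<close> both amount to \<open>P \<i> = Q 1\<close> (equality of mixed
  partials) and \<open>Q \<i> = - P 1\<close> (the Laplace equation).
\<close>

lemma harmonic_wirtinger_holomorphic:
  assumes S: "open S" and f: "harmonic_on f S"
  shows "wirtinger f holomorphic_on S" "(\<lambda>z. cnj (wirtinger_bar f z)) holomorphic_on S"
proof -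
  have "wirtinger f field_differentiable (at z) \<and> (\<lambda>z. cnj (wirtinger_bar f z)) field_differentiable (at z)"
    if z: "z \<in> S" for z
  proof -
    define P where "P = frechet_derivative (partial_x f) (at z)"
    define Q where "Q = frechet_derivative (partial_y f) (at z)"
    have P: "(partial_x f has_derivative P) (at z)" and Q: "(partial_y f has_derivative Q) (at z)"
      using f z by (auto simp: harmonic_on_def C2_on_def P_def Q_def frechet_derivative_works)
    have D: "(f has_derivative frechet_derivative f (at x)) (at x)" if "x \<in> S" for x
      using f that by (auto simp: harmonic_on_def C2_on_def frechet_derivative_works)
    have sym: "P \<i> = Q 1"
      using symmetric_second_derivative[OF S z D, of 1 P \<i> Q] P Q 
      by (simp add: partial_x_def[abs_def] partial_y_def[abs_def])
    have lap: "Q \<i> = - P 1"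
      using f z by (auto simp: harmonic_on_def partial_x_def[of "partial_x f"] partial_y_def[of "partial_y f"] P_def Q_def
        add_eq_0_iff)
    have 1: "(wirtinger f has_derivative (\<lambda>h. (P h - \<i> * Q h) / 2)) (at z)"
      using has_derivative_mult_right[OF has_derivative_diff[OF P has_derivative_mult_right[OF Q, of \<i>]], of "1/2"]
      by (simp add: wirtinger_def[abs_def])
    have 2: "((\<lambda>z. cnj (wirtinger_bar f z)) has_derivative (\<lambda>h. cnj ((P h + \<i> * Q h) / 2))) (at z)"
      using has_derivative_cnj[OF has_derivative_mult_right[OF has_derivative_add[OF P has_derivative_mult_right[OF Q, of \<i>]], of "1/2"]]
      by (simp add: wirtinger_bar_def[abs_def])
    show ?thesis
      using complex_linear_has_field_derivative[OF 1] complex_linear_has_field_derivative[OF 2] sym lap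
      by (auto simp: field_differentiable_def algebra_simps)
  qed
  then show "wirtinger f holomorphic_on S" "(\<lambda>z. cnj (wirtinger_bar f z)) holomorphic_on S"
    by (auto simp: holomorphic_on_def intro: field_differentiable_at_within)
qed

section \<open>Integrals over the unit disk\<close>

lemma disk_absolutely_integrable:
  fixes f :: "complex \<Rightarrow> real"
  assumes "continuous_on (ball 0 1) f" "\<And>z. z \<in> ball 0 1 \<Longrightarrow> \<bar>f z\<bar> \<le> B"
  shows "f absolutely_integrable_on ball 0 1"
proof (rule measurable_bounded_by_integrable_imp_absolutely_integrable)
  show "f \<in> borel_measurable (lebesgue_on (ball 0 1))"
    using assms(1) by (rule continuous_imp_measurable_on_sets_lebesgue) simp
  show "(\<lambda>_. B) integrable_on (ball (0::complex) 1)"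
    by (rule integrable_on_const) simp
qed (use assms in auto)

lemma integral_disk_const: "integral (ball (0::complex) 1) (\<lambda>_. c) = pi * (c::real)"
proof -
  have "integral (ball (0::complex) 1) (\<lambda>_. c) = c * measure lebesgue (ball (0::complex) 1)"
    using integral_mult_right[of "ball (0::complex) 1" c "\<lambda>_. 1"] by (simp flip: lmeasure_integral)
  also have "measure lebesgue (ball (0::complex) 1) = pi"
    by (simp add: content_ball unit_ball_vol_2)
  finally show ?thesis by simp
qed

lemma integral_disk_rotate:
  fixes f :: "complex \<Rightarrow> real"
  assumes f: "f absolutely_integrable_on ball 0 1" and c: "cmod c = 1"
  shows "integral (ball 0 1) (\<lambda>z. f (c * z)) = integral (ball 0 1) f"
proof -
  have "(*) c ` ball 0 1 = ball 0 1"
  proof (intro equalityI subsetI)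
    fix w :: complex assume "w \<in> ball 0 1"
    then have "w = c * (w / c)" "w / c \<in> ball 0 1"
      using c by (auto simp: norm_divide)
    then show "w \<in> (*) c ` ball 0 1" by blast
  qed (use c in \<open>auto simp: norm_mult\<close>)
  moreover have "area_factor ((*) c) = 1"
    using cmod_power2[of c] c by (simp add: area_factor_def power2_eq_square)
  moreover have "((*) c has_derivative (*) c) (at z within ball 0 1)" for z
    by (auto intro!: derivative_eq_intros)
  moreover have "inj_on ((*) c) (ball 0 1)"
    using c by (intro inj_onI) auto
  ultimately show ?thesis
    using complex_change_of_variables[of "ball 0 1" "(*) c" "\<lambda>_. (*) c" f "integral (ball 0 1) f"] f
    by simp
qed

text \<open>
  A rotation by \<open>\<pi> / n\<close> changes the sign of the integrand but not the integral.
\<close>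

lemma integral_disk_Re_monomial:
  assumes n: "n > 0"
  shows "integral (ball 0 1) (\<lambda>z. Re (a * z ^ n)) = 0"
proof -
  define c where "c = exp (\<i> * of_real (pi / n))"
  have "c ^ n = exp (\<i> * of_real pi)"
    using n by (simp add: c_def flip: exp_of_nat_mult)
  then have cn: "c ^ n = -1" by simp
  have "(\<lambda>z. Re (a * z ^ n)) absolutely_integrable_on ball 0 1"
  proof (rule disk_absolutely_integrable)
    fix z :: complex assume z: "z \<in> ball 0 1"
    have "\<bar>Re (a * z ^ n)\<bar> \<le> cmod a * cmod z ^ n"
      by (metis abs_Re_le_cmod norm_mult norm_power)
    also have "\<dots> \<le> cmod a * 1"
      using z by (intro mult_left_mono power_le_one) auto
    finally show "\<bar>Re (a * z ^ n)\<bar> \<le> cmod a" by simp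
  qed (intro continuous_intros)
  moreover have "cmod c = 1"
    by (simp add: c_def)
  ultimately have "integral (ball 0 1) (\<lambda>z. Re (a * (c * z) ^ n)) = integral (ball 0 1) (\<lambda>z. Re (a * z ^ n))"
    by (rule integral_disk_rotate)
  moreover have "(\<lambda>z. Re (a * (c * z) ^ n)) = (\<lambda>z. - Re (a * z ^ n))"
    by (simp add: power_mult_distrib cn)
  ultimately have "- integral (ball 0 1) (\<lambda>z. Re (a * z ^ n)) = integral (ball 0 1) (\<lambda>z. Re (a * z ^ n))"
    by (simp only: integral_neg)
  then show ?thesis by simp
qed

text \<open>
  After a dilation by \<open>r < 1\<close> the power series of \<open>\<phi>\<close> converges uniformly on the disk, and it can
  be integrated term by term.
\<close>

lemma integral_disk_Re_dilated:
  assumes hol: "\<phi> holomorphic_on ball 0 1" and 0: "\<phi> 0 = 0" and r: "0 \<le> r" "r < 1"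
  shows "integral (ball 0 1) (\<lambda>z. Re (\<phi> (of_real r * z))) = 0"
proof -
  define a where "a = (\<lambda>n. (deriv ^^ n) \<phi> 0 / fact n)"
  have ps: "(\<lambda>n. a n * w ^ n) sums \<phi> w" if "cmod w < 1" for w
    using holomorphic_power_series[OF hol, of w] that by (simp add: a_def)
  have a0: "a 0 = 0" using 0 by (simp add: a_def)
  \<comment> \<open>Convergence of the series at \<open>s\<close> yields absolute convergence at the smaller radius \<open>r\<close>.\<close>
  obtain s where s: "r < s" "s < 1" using r dense by blast
  have "summable (\<lambda>n. a n * of_real s ^ n)"
    using ps[of "of_real s"] s r by (simp add: sums_iff)
  from powser_insidea[OF this, of "of_real r"]
  have summ: "summable (\<lambda>n. cmod (a n) * r ^ n)"
    using r s by (simp add: norm_mult norm_power)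
  define F where "F = (\<lambda>k z. \<Sum>n<k. Re (a n * of_real r ^ n * z ^ n))"
  have intg: "(\<lambda>z. Re (b * z ^ n)) integrable_on ball 0 1" for b n
  proof (rule set_lebesgue_integral_eq_integral(1)[OF disk_absolutely_integrable[where B = "cmod b"]])
    fix z :: complex assume z: "z \<in> ball 0 1"
    have "\<bar>Re (b * z ^ n)\<bar> \<le> cmod b * cmod z ^ n"
      by (metis abs_Re_le_cmod norm_mult norm_power)
    also have "\<dots> \<le> cmod b * 1"
      using z by (intro mult_left_mono power_le_one) auto
    finally show "\<bar>Re (b * z ^ n)\<bar> \<le> cmod b" by simp
  qed (intro continuous_intros)
  have F0: "integral (ball 0 1) (F k) = 0" for k
  proof -
    have "integral (ball 0 1) (F k) = (\<Sum>n<k. integral (ball 0 1) (\<lambda>z. Re (a n * of_real r ^ n * z ^ n)))"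
      unfolding F_def by (rule integral_sum) (simp, rule intg)
    also have "\<dots> = 0"
    proof (rule sum.neutral, intro ballI)
      fix n show "integral (ball 0 1) (\<lambda>z. Re (a n * of_real r ^ n * z ^ n)) = 0"
        by (cases "n = 0") (simp_all only: integral_disk_Re_monomial a0, simp_all)
    qed
    finally show ?thesis .
  qed
  have "(\<lambda>k. integral (ball 0 1) (F k)) \<longlonglongrightarrow> integral (ball 0 1) (\<lambda>z. Re (\<phi> (of_real r * z)))"
  proof (rule dominated_convergence(2))
    show "F k integrable_on ball 0 1" for k
      unfolding F_def by (intro integrable_sum intg) auto
    show "(\<lambda>_. \<Sum>n. cmod (a n) * r ^ n) integrable_on ball (0::complex) 1"
      by (rule integrable_on_const) simp
  next
    fix k and z :: complex assume z: "z \<in> ball 0 1"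
    have "norm (F k z) \<le> (\<Sum>n<k. norm (Re (a n * of_real r ^ n * z ^ n)))"
      unfolding F_def by (rule norm_sum)
    also have "\<dots> \<le> (\<Sum>n<k. cmod (a n) * r ^ n)"
    proof (rule sum_mono)
      fix n
      have "norm (Re (a n * of_real r ^ n * z ^ n)) \<le> cmod (a n) * r ^ n * cmod z ^ n"
        using abs_Re_le_cmod[of "a n * of_real r ^ n * z ^ n"] r by (simp add: norm_mult norm_power)
      also have "\<dots> \<le> cmod (a n) * r ^ n * 1"
        using z r by (intro mult_left_mono power_le_one) auto
      finally show "norm (Re (a n * of_real r ^ n * z ^ n)) \<le> cmod (a n) * r ^ n" by simp
    qed
    also have "\<dots> \<le> (\<Sum>n. cmod (a n) * r ^ n)"
      using summ r by (intro sum_le_suminf) auto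
    finally show "norm (F k z) \<le> (\<Sum>n. cmod (a n) * r ^ n)" .
  next
    fix z :: complex assume z: "z \<in> ball 0 1"
    have "r * cmod z < 1"
      using z r mult_le_one[of r "cmod z"] by (cases "r = 0") (auto intro: le_less_trans[OF mult_right_le_one_le])
    then have "(\<lambda>n. a n * (of_real r * z) ^ n) sums \<phi> (of_real r * z)"
      using r by (intro ps) (simp add: norm_mult)
    from sums_Re[OF this] show "(\<lambda>k. F k z) \<longlonglongrightarrow> Re (\<phi> (of_real r * z))"
      by (simp add: sums_def F_def power_mult_distrib mult.assoc)
  qed
  then show ?thesis by (simp add: F0 LIMSEQ_const_iff)
qed

text \<open>
  The mean value property in integrated form.  Boundedness lets the dilation factor tend to 1
  under the integral.
\<close>

lemma integral_disk_Re_holomorphic: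
  assumes hol: "\<phi> holomorphic_on ball 0 1" and 0: "\<phi> 0 = 0"
    and B: "\<And>z. z \<in> ball 0 1 \<Longrightarrow> cmod (\<phi> z) \<le> B"
  shows "integral (ball 0 1) (\<lambda>z. Re (\<phi> z)) = 0"
proof -
  define r where "r = (\<lambda>k::nat. 1 - 1 / (real k + 1))"
  have r: "0 \<le> r k" "r k < 1" for k
    by (auto simp: r_def field_simps)
  have rlim: "r \<longlonglongrightarrow> 1"
    unfolding r_def using LIMSEQ_inverse_real_of_nat[THEN tendsto_diff[OF tendsto_const[of 1]]]
    by (simp add: inverse_eq_divide add.commute)
  have cont: "continuous_on (ball 0 1) \<phi>"
    using hol by (rule holomorphic_on_imp_continuous_on)
  have in_ball: "of_real (r k) * z \<in> ball 0 1" if "z \<in> ball 0 1" for k and z :: complex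
  proof -
    have "r k * cmod z \<le> cmod z"
      using r[of k] by (intro mult_left_le_one_le) auto
    with that r[of k] show ?thesis by (simp add: norm_mult)
  qed
  have "(\<lambda>k. integral (ball 0 1) (\<lambda>z. Re (\<phi> (of_real (r k) * z)))) \<longlonglongrightarrow> integral (ball 0 1) (\<lambda>z. Re (\<phi> z))"
  proof (rule dominated_convergence(2))
    show "(\<lambda>_. B) integrable_on ball (0::complex) 1"
      by (rule integrable_on_const) simp
    show le: "norm (Re (\<phi> (of_real (r k) * z))) \<le> B" if "z \<in> ball 0 1" for k z
      using B[OF in_ball[OF that]] abs_Re_le_cmod order_trans by (metis real_norm_def)
    show "(\<lambda>z. Re (\<phi> (of_real (r k) * z))) integrable_on ball 0 1" for k
    proof (rule set_lebesgue_integral_eq_integral(1)[OF disk_absolutely_integrable])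
      show "continuous_on (ball 0 1) (\<lambda>z. Re (\<phi> (of_real (r k) * z)))"
        using in_ball by (intro continuous_intros continuous_on_compose2[OF cont]) auto
    qed (use le in auto)
  next
    fix z :: complex assume z: "z \<in> ball 0 1"
    have "isCont \<phi> z"
      using cont z by (simp add: continuous_on_eq_continuous_at)
    moreover have "(\<lambda>k. of_real (r k) * z) \<longlonglongrightarrow> z"
      using tendsto_mult[OF tendsto_of_real[OF rlim] tendsto_const[of z]] by simp
    ultimately show "(\<lambda>k. Re (\<phi> (of_real (r k) * z))) \<longlonglongrightarrow> Re (\<phi> z)"
      by (intro tendsto_Re) (rule isCont_tendsto_compose)
  qed
  then show ?thesis
    using integral_disk_Re_dilated[OF hol 0 r] by (simp add: LIMSEQ_const_iff)
qed

text \<open>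
  The map \<open>z \<mapsto> |z| z\<close> is a bijection of the disk with Jacobian \<open>2 |z|\<^sup>2\<close>, so that twice the
  integral is the area of the disk.
\<close>

lemma integral_disk_norm_square: "integral (ball 0 1) (\<lambda>z. (cmod z)\<^sup>2) = pi / 2"
proof -
  define g :: "complex \<Rightarrow> complex" where "g = (\<lambda>z. cmod z *\<^sub>R z)"
  define g' :: "complex \<Rightarrow> complex \<Rightarrow> complex" where
    "g' = (\<lambda>z. if z = 0 then (\<lambda>h. 0) else (\<lambda>h. cmod z *\<^sub>R h + (h \<bullet> sgn z) *\<^sub>R z))"
  have der: "(g has_derivative g' z) (at z within ball 0 1)" for z
  proof (cases "z = 0")
    case True
    have "(\<lambda>h::complex. norm (cmod h *\<^sub>R h) / norm h) \<midarrow>0\<rightarrow> 0"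
    proof -
      have "(\<lambda>h::complex. norm (cmod h *\<^sub>R h) / norm h) = cmod" by auto
      then show ?thesis
        using tendsto_norm_zero[OF tendsto_ident_at[of "0::complex" UNIV]] by simp
    qed
    then have "(g has_derivative g' 0) (at 0)"
      unfolding has_derivative_at g_def g'_def by simp
    then show ?thesis using True has_derivative_at_withinI by blast
  next
    case False
    then have "(g has_derivative g' z) (at z)"
      unfolding g_def g'_def by (auto intro!: derivative_eq_intros has_derivative_norm)
    then show ?thesis by (rule has_derivative_at_withinI)
  qed
  have factor: "area_factor (g' z) = 2 * (cmod z)\<^sup>2" for z
  proof (cases "z = 0")
    case True then show ?thesis by (simp add: g'_def area_factor_def)
  next
    case False
    \<comment> \<open>In polar form \<open>z = \<rho> (c + \<i> s)\<close> the Jacobian becomes \<open>\<rho>\<^sup>2 (1 + c\<^sup>2 + s\<^sup>2)\<close>.\<close>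
    define c where "c = Re (sgn z)"
    define s where "s = Im (sgn z)"
    define \<rho> where "\<rho> = cmod z"
    have cs: "c\<^sup>2 + s\<^sup>2 = 1"
      using False norm_sgn[of z] cmod_power2[of "sgn z"] by (simp add: c_def s_def)
    have "z = Complex (\<rho> * c) (\<rho> * s)"
      using False by (simp add: complex_eq_iff \<rho>_def c_def s_def sgn_div_norm)
    then have "g' z 1 = Complex (\<rho> + c * (\<rho> * c)) (c * (\<rho> * s))"
      "g' z \<i> = Complex (s * (\<rho> * c)) (\<rho> + s * (\<rho> * s))"
      using False by (auto simp: g'_def complex_eq_iff inner_complex_def c_def s_def simp flip: \<rho>_def)
    then have "Im (cnj (g' z 1) * g' z \<i>) = \<rho>\<^sup>2 * (1 + (c\<^sup>2 + s\<^sup>2))"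
      by (simp add: power2_eq_square algebra_simps)
    then show ?thesis by (simp add: cs area_factor_def \<rho>_def)
  qed
  have "inj_on g (ball 0 1)"
  proof (rule inj_onI)
    fix z w assume eq: "g z = g w"
    then have "cmod (g z) = cmod (g w)" by simp
    then have "(cmod z)\<^sup>2 = (cmod w)\<^sup>2" by (simp add: g_def power2_eq_square)
    then have n: "cmod z = cmod w" by simp
    then show "z = w" using eq by (cases "w = 0") (auto simp: g_def)
  qed
  moreover have "g ` ball 0 1 = ball 0 1"
  proof (intro equalityI subsetI)
    fix w assume "w \<in> g ` ball 0 1"
    then obtain z where z: "cmod z < 1" "w = g z" by auto
    then have "cmod z * cmod z < 1 * 1"
      by (intro mult_strict_mono') auto
    then show "w \<in> ball 0 1"
      using z by (simp add: g_def)
  next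
    fix w :: complex assume w: "w \<in> ball 0 1"
    define z where "z = (1 / sqrt (cmod w)) *\<^sub>R w"
    have nz: "cmod z = sqrt (cmod w)"
      by (simp add: z_def real_div_sqrt)
    then have "g z = w"
      by (cases "w = 0") (simp_all add: g_def z_def)
    moreover have "z \<in> ball 0 1"
      using w nz by simp
    ultimately show "w \<in> g ` ball 0 1" by blast
  qed
  moreover have "(\<lambda>_. 1::real) absolutely_integrable_on ball (0::complex) 1"
    by (rule disk_absolutely_integrable[where B = 1]) auto
  ultimately have "integral (ball 0 1) (\<lambda>z. area_factor (g' z) * 1) = pi"
    using complex_change_of_variables[of "ball 0 1" g g' "\<lambda>_. 1" pi] der integral_disk_const[of 1] by simp
  then show ?thesis by (simp add: factor)
qed

section \<open>The area integral\<close>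

text \<open>
  For every unimodular \<open>u\<close> the function \<open>\<phi> + u \<psi>\<close> maps the disk into itself and fixes 0.  At a
  given \<open>z\<close>, choosing \<open>u\<close> so that the two summands point in the same direction turns the Schwarz
  lemma into the claim.
\<close>

lemma Schwarz_norm_sum:
  assumes hol: "\<phi> holomorphic_on ball 0 1" "\<psi> holomorphic_on ball 0 1"
    and 0: "\<phi> 0 = 0" "\<psi> 0 = 0"
    and less: "\<And>z. z \<in> ball 0 1 \<Longrightarrow> cmod (\<phi> z) + cmod (\<psi> z) < 1"
    and z: "z \<in> ball 0 1"
  shows "cmod (\<phi> z) + cmod (\<psi> z) \<le> cmod z"
proof -
  define u where "u = (if \<phi> z = 0 \<or> \<psi> z = 0 then 1 else sgn (\<phi> z) * cnj (sgn (\<psi> z)))"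
  have u: "cmod u = 1"
    by (simp add: u_def norm_mult norm_sgn)
  have "cmod (\<phi> z + u * \<psi> z) \<le> cmod z"
  proof (rule Schwarz_Lemma(1)[of "\<lambda>w. \<phi> w + u * \<psi> w"])
    show "(\<lambda>w. \<phi> w + u * \<psi> w) holomorphic_on ball 0 1"
      using hol by (intro holomorphic_intros)
    fix w :: complex assume "cmod w < 1"
    then show "cmod (\<phi> w + u * \<psi> w) < 1"
      using less[of w] norm_triangle_ineq[of "\<phi> w" "u * \<psi> w"] u by (simp add: norm_mult)
  qed (use 0 z in auto)
  moreover have "cmod (\<phi> z + u * \<psi> z) = cmod (\<phi> z) + cmod (\<psi> z)"
  proof (cases "\<phi> z = 0 \<or> \<psi> z = 0")
    case True
    then show ?thesis by (auto simp: u_def)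
  next
    case False
    have polar: "sgn w * of_real (cmod w) = w" "cnj (sgn w) * w = of_real (cmod w)" for w
    proof -
      show "sgn w * of_real (cmod w) = w"
        by (cases "w = 0") (simp_all add: sgn_eq)
      have "cnj w * w = of_real (cmod w) * of_real (cmod w)"
        using complex_norm_square[of w] by (simp add: power2_eq_square mult.commute)
      then show "cnj (sgn w) * w = of_real (cmod w)"
        by (cases "w = 0") (simp_all add: sgn_eq)
    qed

    have "\<phi> z + u * \<psi> z = sgn (\<phi> z) * of_real (cmod (\<phi> z)) + sgn (\<phi> z) * (cnj (sgn (\<psi> z)) * \<psi> z)"
      using False by (simp add: u_def polar(1) mult.assoc)
    also have "\<dots> = sgn (\<phi> z) * of_real (cmod (\<phi> z) + cmod (\<psi> z))"
      by (simp add: polar(2) distrib_left)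
    finally show ?thesis
      using False by (simp add: norm_mult norm_sgn del: of_real_add)
  qed
  ultimately show ?thesis by simp
qed

lemma area_factor_wirtinger:
  "area_factor (\<lambda>h. a * h + b * cnj h) = \<bar>(cmod a)\<^sup>2 - (cmod b)\<^sup>2\<bar>"
proof -
  have "Im (cnj (a + b) * (a * \<i> - b * \<i>)) = (cmod a)\<^sup>2 - (cmod b)\<^sup>2"
    unfolding cmod_power2 by (simp add: power2_eq_square algebra_simps)
  then show ?thesis by (simp add: area_factor_def)
qed

text \<open>
  The slack in the bound \<open>|\<phi>|\<^sup>2 - |\<psi>|\<^sup>2 \<le> |z|\<^sup>2\<close>; its integral is what the area integral lacks
  to the maximum.
\<close>

definition defect :: "(complex \<Rightarrow> complex) \<Rightarrow> (complex \<Rightarrow> complex) \<Rightarrow> complex \<Rightarrow> real" where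
  "defect \<phi> \<psi> z = (cmod z)\<^sup>2 - (cmod (\<phi> z))\<^sup>2 + (cmod (\<psi> z))\<^sup>2"

text \<open>
  The bound makes \<open>|1 + \<phi>| \<ge> |\<psi>|\<close>, so the Jacobian is
  \<open>|1 + \<phi>|\<^sup>2 - |\<psi>|\<^sup>2 = 1 + 2 Re \<phi> + |z|\<^sup>2 - defect\<close>.  The first three terms integrate to
  \<open>\<pi>\<close>, 0 and \<open>\<pi> / 2\<close>.
\<close>

lemma integral_area_factor:
  assumes hol: "\<phi> holomorphic_on ball 0 1" "\<psi> holomorphic_on ball 0 1"
    and 0: "\<phi> 0 = 0"
    and le: "\<And>z. z \<in> ball 0 1 \<Longrightarrow> cmod (\<phi> z) + cmod (\<psi> z) \<le> cmod z"
  shows "(\<lambda>z. area_factor (\<lambda>h. (1 + \<phi> z) * h + \<psi> z * cnj h)) absolutely_integrable_on ball 0 1"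
    and "defect \<phi> \<psi> absolutely_integrable_on ball 0 1"
    and "integral (ball 0 1) (\<lambda>z. area_factor (\<lambda>h. (1 + \<phi> z) * h + \<psi> z * cnj h)) =
      3 * pi / 2 - integral (ball 0 1) (defect \<phi> \<psi>)"
proof -
  have cont: "continuous_on (ball 0 1) \<phi>" "continuous_on (ball 0 1) \<psi>"
    using hol by (auto intro: holomorphic_on_imp_continuous_on)
  have b: "cmod (\<phi> z) \<le> 1" "cmod (\<psi> z) \<le> 1" "cmod z \<le> 1" if "z \<in> ball 0 1" for z
    using le[OF that] that norm_ge_zero[of "\<phi> z"] norm_ge_zero[of "\<psi> z"] by (simp_all, linarith+)
  have sq: "(cmod (\<phi> z))\<^sup>2 \<le> 1" "(cmod (\<psi> z))\<^sup>2 \<le> 1" "(cmod z)\<^sup>2 \<le> 1" if "z \<in> ball 0 1" for z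
    using b[OF that] by (simp_all add: power_le_one)
  show D: "defect \<phi> \<psi> absolutely_integrable_on ball 0 1"
  proof (rule disk_absolutely_integrable[where B = 3])
    show "continuous_on (ball 0 1) (defect \<phi> \<psi>)"
      unfolding defect_def[abs_def] by (intro continuous_intros cont)
    fix z :: complex assume "z \<in> ball 0 1"
    then show "\<bar>defect \<phi> \<psi> z\<bar> \<le> 3"
      using sq[of z] zero_le_power2[of "cmod z"] zero_le_power2[of "cmod (\<phi> z)"] zero_le_power2[of "cmod (\<psi> z)"]
      unfolding defect_def abs_le_iff by (intro conjI; linarith)
  qed
  have R: "(\<lambda>z. Re (\<phi> z)) absolutely_integrable_on ball 0 1"
  proof (rule disk_absolutely_integrable[where B = 1])
    show "continuous_on (ball 0 1) (\<lambda>z. Re (\<phi> z))"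
      by (intro continuous_intros cont)
    show "\<bar>Re (\<phi> z)\<bar> \<le> 1" if "z \<in> ball 0 1" for z
      using order_trans[OF abs_Re_le_cmod b(1)[OF that]] .
  qed
  have Z: "(\<lambda>z. (cmod z)\<^sup>2) absolutely_integrable_on ball 0 1"
    by (rule disk_absolutely_integrable[where B = 1]) (intro continuous_intros, use sq in auto)
  have O: "(\<lambda>z. 1::real) absolutely_integrable_on ball (0::complex) 1"
    by (rule disk_absolutely_integrable[where B = 1]) auto
  have eq: "area_factor (\<lambda>h. (1 + \<phi> z) * h + \<psi> z * cnj h) =
      1 + 2 * Re (\<phi> z) + (cmod z)\<^sup>2 - defect \<phi> \<psi> z" if z: "z \<in> ball 0 1" for z
  proof -
    have "cmod (\<psi> z) \<le> 1 - cmod (\<phi> z)"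
      using le[OF z] z by simp
    also have "\<dots> \<le> cmod (1 + \<phi> z)"
      using norm_diff_ineq[of 1 "\<phi> z"] by simp
    finally have "(cmod (\<psi> z))\<^sup>2 \<le> (cmod (1 + \<phi> z))\<^sup>2"
      by (simp add: power_mono)
    moreover have "(cmod (1 + \<phi> z))\<^sup>2 = 1 + 2 * Re (\<phi> z) + (cmod (\<phi> z))\<^sup>2"
      unfolding cmod_power2 by (simp add: power2_eq_square algebra_simps)
    ultimately show ?thesis
      by (simp add: area_factor_wirtinger defect_def)
  qed
  have sum: "(\<lambda>z. 1 + 2 * Re (\<phi> z) + (cmod z)\<^sup>2) absolutely_integrable_on ball 0 1"
    by (intro set_integral_add(1) set_integrable_mult_right O R Z)
  have "(\<lambda>z. 1 + 2 * Re (\<phi> z) + (cmod z)\<^sup>2 - defect \<phi> \<psi> z) absolutely_integrable_on ball 0 1"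
    by (rule set_integral_diff(1)[OF sum D])
  then show "(\<lambda>z. area_factor (\<lambda>h. (1 + \<phi> z) * h + \<psi> z * cnj h)) absolutely_integrable_on ball 0 1"
    by (rule absolutely_integrable_spike_eq[THEN iffD1, rotated -1, of _ _ "{}"]) (auto simp: eq)
  note lift = set_lebesgue_integral_eq_integral(1)
  have "integral (ball 0 1) (\<lambda>z. area_factor (\<lambda>h. (1 + \<phi> z) * h + \<psi> z * cnj h)) =
      integral (ball 0 1) (\<lambda>z. 1 + 2 * Re (\<phi> z) + (cmod z)\<^sup>2 - defect \<phi> \<psi> z)"
    by (rule integral_cong) (rule eq)
  also have "\<dots> = integral (ball 0 1) (\<lambda>z. 1 + 2 * Re (\<phi> z) + (cmod z)\<^sup>2) - integral (ball 0 1) (defect \<phi> \<psi>)"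
    by (rule integral_diff[OF lift[OF sum] lift[OF D]])
  also have "integral (ball 0 1) (\<lambda>z. 1 + 2 * Re (\<phi> z) + (cmod z)\<^sup>2) =
      integral (ball 0 1) (\<lambda>z::complex. 1) + 2 * integral (ball 0 1) (\<lambda>z. Re (\<phi> z)) + integral (ball 0 1) (\<lambda>z. (cmod z)\<^sup>2)"
    using lift[OF O] lift[OF R] lift[OF Z] by (simp add: integral_add integrable_add integrable_on_cmult_left)
  also have "\<dots> = 3 * pi / 2"
    using integral_disk_Re_holomorphic[OF hol(1) 0 b(1)] 
    by (simp only: integral_disk_const integral_disk_norm_square)
  finally show "integral (ball 0 1) (\<lambda>z. area_factor (\<lambda>h. (1 + \<phi> z) * h + \<psi> z * cnj h)) =
      3 * pi / 2 - integral (ball 0 1) (defect \<phi> \<psi>)" .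
qed

lemma defect_nonneg:
  assumes "cmod (\<phi> z) + cmod (\<psi> z) \<le> cmod z"
  shows "0 \<le> defect \<phi> \<psi> z"
proof -
  have "(cmod (\<phi> z))\<^sup>2 \<le> (cmod z)\<^sup>2"
    using assms norm_ge_zero[of "\<psi> z"] by (intro power_mono) (linarith, simp)
  then show ?thesis by (simp add: defect_def)
qed

text \<open>
  A nonnegative continuous function with integral 0 vanishes, so \<open>|\<phi>| = |z|\<close> at some point other
  than 0, and the equality case of the Schwarz lemma applies.
\<close>

lemma zero_integral_defect:
  assumes hol: "\<phi> holomorphic_on ball 0 1" "\<psi> holomorphic_on ball 0 1"
    and 0: "\<phi> 0 = 0"
    and le: "\<And>z. z \<in> ball 0 1 \<Longrightarrow> cmod (\<phi> z) + cmod (\<psi> z) \<le> cmod z"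
    and int0: "integral (ball 0 1) (defect \<phi> \<psi>) = 0"
  obtains \<alpha> where "cmod \<alpha> = 1" "\<And>z. z \<in> ball 0 1 \<Longrightarrow> \<phi> z = \<alpha> * z" "\<And>z. z \<in> ball 0 1 \<Longrightarrow> \<psi> z = 0"
proof -
  have cont: "continuous_on (ball 0 1) (defect \<phi> \<psi>)"
    using hol unfolding defect_def[abs_def] by (intro continuous_intros holomorphic_on_imp_continuous_on)
  \<comment> \<open>Any square inside the disk and away from 0 would do.\<close>
  define a where "a = Complex (1/4) (1/4)"
  define b where "b = Complex (1/3) (1/3)"
  have sub: "cbox a b \<subseteq> ball 0 1"
  proof
    fix z assume "z \<in> cbox a b"
    then have "\<bar>Re z\<bar> \<le> 1/3" "\<bar>Im z\<bar> \<le> 1/3"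
      by (auto simp: in_cbox_complex_iff a_def b_def)
    then show "z \<in> ball 0 1"
      using cmod_le[of z] by simp
  qed
  have integ: "defect \<phi> \<psi> integrable_on ball 0 1"
    using integral_area_factor(2)[OF hol 0 le] set_lebesgue_integral_eq_integral(1) by blast
  have nonneg: "0 \<le> defect \<phi> \<psi> z" if "z \<in> ball 0 1" for z
    using le[OF that] by (rule defect_nonneg)
  have cont': "continuous_on (cbox a b) (defect \<phi> \<psi>)"
    using cont sub by (rule continuous_on_subset)
  have integ': "defect \<phi> \<psi> integrable_on cbox a b"
    using cont' by (rule integrable_continuous)
  have "integral (cbox a b) (defect \<phi> \<psi>) \<le> 0"
    using integral_subset_le[OF sub integ' integ] nonneg int0 by simp
  moreover have "integral (cbox a b) (defect \<phi> \<psi>) \<ge> 0"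
    using integ' sub nonneg by (intro integral_nonneg) auto
  moreover have "box a b \<noteq> {}"
    by (simp add: box_ne_empty Basis_complex_def a_def b_def inner_complex_def)
  ultimately have "\<forall>z\<in>cbox a b. defect \<phi> \<psi> z = 0"
    using integral_cbox_eq_0_iff[OF cont' _ nonneg[OF subsetD[OF sub]]] by (metis order_antisym)
  moreover have a: "a \<in> cbox a b"
    by (simp add: in_cbox_complex_iff a_def b_def)
  ultimately have "defect \<phi> \<psi> a = 0" by blast
  then have "(cmod a)\<^sup>2 \<le> (cmod (\<phi> a))\<^sup>2"
    unfolding defect_def using zero_le_power2[of "cmod (\<psi> a)"] by linarith
  then have "cmod a \<le> cmod (\<phi> a)"
    by (rule power2_le_imp_le) simp
  moreover have aD: "a \<in> ball 0 1" using a sub by blast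
  ultimately have "cmod (\<phi> a) = cmod a"
    using le[OF aD] norm_ge_zero[of "\<psi> a"] by linarith
  moreover have "a \<noteq> 0" by (simp add: a_def complex_eq_iff)
  ultimately have ex: "\<exists>z. cmod z < 1 \<and> z \<noteq> 0 \<and> cmod (\<phi> z) = cmod z"
    using aD by auto
  have lt: "cmod (\<phi> z) < 1" if "cmod z < 1" for z
    using le[of z] that norm_ge_zero[of "\<psi> z"] unfolding mem_ball_0 by linarith
  have "\<exists>\<alpha>. (\<forall>z. cmod z < 1 \<longrightarrow> \<phi> z = \<alpha> * z) \<and> cmod \<alpha> = 1"
    by (rule Schwarz_Lemma(3)[OF hol(1) 0 lt, of 0]) (use ex in auto)
  then obtain \<alpha> where \<alpha>: "cmod \<alpha> = 1" "\<And>z. cmod z < 1 \<Longrightarrow> \<phi> z = \<alpha> * z" by blast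
  show thesis
  proof (rule that[OF \<alpha>(1)])
    fix z :: complex assume z: "z \<in> ball 0 1"
    then show "\<phi> z = \<alpha> * z" using \<alpha> by simp
    then show "\<psi> z = 0" using le[OF z] \<alpha>(1) by (simp add: norm_mult)
  qed
qed

section \<open>The class and its extremal functions\<close>

lemma FH0_differentiable:
  assumes "f \<in> FH0" "z \<in> ball 0 1"
  shows "f differentiable (at z)"
  using assms by (auto simp: FH0_def harmonic_on_def C2_on_def)

text \<open>
  In terms of a decomposition \<open>f = h + cnj g\<close> with holomorphic \<open>h\<close> and \<open>g\<close>, these functions are
  \<open>\<phi> = h' - 1\<close> and \<open>\<psi> = g'\<close>.
\<close>

lemma FH0_decomposition:
  assumes f: "f \<in> FH0"
  defines "\<phi> \<equiv> \<lambda>z. wirtinger f z - 1" and "\<psi> \<equiv> \<lambda>z. cnj (wirtinger_bar f z)"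
  shows "\<phi> holomorphic_on ball 0 1" "\<psi> holomorphic_on ball 0 1" "\<phi> 0 = 0"
    "\<And>z. z \<in> ball 0 1 \<Longrightarrow> cmod (\<phi> z) + cmod (\<psi> z) \<le> cmod z"
proof -
  have h: "harmonic_on f (ball 0 1)"
    using f by (simp add: FH0_def)
  show hol: "\<phi> holomorphic_on ball 0 1" "\<psi> holomorphic_on ball 0 1"
    unfolding \<phi>_def \<psi>_def using harmonic_wirtinger_holomorphic[OF open_ball h]
    by (auto intro!: holomorphic_intros)
  show 0: "\<phi> 0 = 0"
    using f by (simp add: \<phi>_def FH0_def)
  have psi0: "\<psi> 0 = 0"
    using f by (simp add: \<psi>_def FH0_def)
  have "cmod (\<phi> z) + cmod (\<psi> z) < 1" if "z \<in> ball 0 1" for z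
  proof -
    have "cmod (wirtinger f z - 1) < 1 - cmod (wirtinger_bar f z)"
      using f that unfolding FH0_def by blast
    then show ?thesis by (simp add: \<phi>_def \<psi>_def)
  qed
  from Schwarz_norm_sum[OF hol 0 psi0 this]
  show "\<And>z. z \<in> ball 0 1 \<Longrightarrow> cmod (\<phi> z) + cmod (\<psi> z) \<le> cmod z" .
qed

lemma FH0_area_le:
  assumes f: "f \<in> FH0"
  shows "area (f ` ball 0 1) \<le> ennreal (3 * pi / 2 -
    integral (ball 0 1) (defect (\<lambda>z. wirtinger f z - 1) (\<lambda>z. cnj (wirtinger_bar f z))))"
proof -
  have "area_factor (\<lambda>h. (1 + (wirtinger f z - 1)) * h + cnj (wirtinger_bar f z) * cnj h) =
      area_factor (\<lambda>h. wirtinger f z * h + wirtinger_bar f z * cnj h)" for z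
    by (simp add: area_factor_wirtinger)
  then have i: "(\<lambda>z. area_factor (\<lambda>h. wirtinger f z * h + wirtinger_bar f z * cnj h)) absolutely_integrable_on ball 0 1"
    "integral (ball 0 1) (\<lambda>z. area_factor (\<lambda>h. wirtinger f z * h + wirtinger_bar f z * cnj h)) = 3 * pi / 2 -
    integral (ball 0 1) (defect (\<lambda>z. wirtinger f z - 1) (\<lambda>z. cnj (wirtinger_bar f z)))"
    using integral_area_factor(1,3)[OF FH0_decomposition[OF f]] by simp_all
  show ?thesis
    unfolding area_def i(2)[symmetric]
    by (rule complex_area_le(2)[OF _ _ i(1)])
       (auto intro!: has_derivative_at_withinI[OF has_derivative_wirtinger] FH0_differentiable[OF f])
qed

lemma FH0_area_le_max:
  assumes f: "f \<in> FH0"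
  shows "area (f ` ball 0 1) \<le> ennreal (3 * pi / 2)"
proof -
  note d = FH0_decomposition[OF f]
  have "0 \<le> integral (ball 0 1) (defect (\<lambda>z. wirtinger f z - 1) (\<lambda>z. cnj (wirtinger_bar f z)))"
    using integral_area_factor(2)[OF d] d(4)
    by (intro integral_nonneg defect_nonneg set_lebesgue_integral_eq_integral(1)) auto
  then show ?thesis
    using FH0_area_le[OF f] by (elim order_trans) (simp add: ennreal_leI)
qed

text \<open>
  Maximal area leaves no room for a defect, so \<open>f_z = 1 + \<alpha> z\<close> and \<open>f_{\bar z} = 0\<close> on the disk;
  integrating recovers \<open>f\<close>.
\<close>

lemma FH0_area_max_imp:
  assumes f: "f \<in> FH0" and max: "area (f ` ball 0 1) = ennreal (3 * pi / 2)"
  obtains \<alpha> where "cmod \<alpha> = 1" "\<And>z. z \<in> ball 0 1 \<Longrightarrow> f z = z + \<alpha> * z\<^sup>2 / 2"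
proof -
  note d = FH0_decomposition[OF f]
  let ?I = "integral (ball 0 1) (defect (\<lambda>z. wirtinger f z - 1) (\<lambda>z. cnj (wirtinger_bar f z)))"
  have "0 \<le> ?I"
    using integral_area_factor(2)[OF d] d(4)
    by (intro integral_nonneg defect_nonneg set_lebesgue_integral_eq_integral(1)) auto
  moreover have "?I \<le> 0"
  proof (rule ccontr)
    assume "\<not> ?I \<le> 0"
    then have "ennreal (3 * pi / 2 - ?I) < ennreal (3 * pi / 2)"
      by (intro ennreal_lessI) auto
    then show False
      using FH0_area_le[OF f] max by simp
  qed
  ultimately have "?I = 0" by simp
  from zero_integral_defect[OF d this]
  obtain \<alpha> where \<alpha>: "cmod \<alpha> = 1" "\<And>z. z \<in> ball 0 1 \<Longrightarrow> wirtinger f z - 1 = \<alpha> * z"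
    "\<And>z. z \<in> ball 0 1 \<Longrightarrow> cnj (wirtinger_bar f z) = 0" by metis
  define E where "E = (\<lambda>z. f z - (z + \<alpha> * z\<^sup>2 / 2))"
  have "(E has_derivative (\<lambda>h. 0)) (at z within ball 0 1)" if z: "z \<in> ball 0 1" for z
  proof -
    have w: "wirtinger f z = 1 + \<alpha> * z" "wirtinger_bar f z = 0"
      using \<alpha>(2,3)[OF z] by (simp_all add: algebra_simps)
    have "(f has_derivative (\<lambda>h. (1 + \<alpha> * z) * h)) (at z)"
      using has_derivative_wirtinger[OF FH0_differentiable[OF f z]] by (simp add: w)
    moreover have "((\<lambda>z. z + \<alpha> * z\<^sup>2 / 2) has_derivative (\<lambda>h. (1 + \<alpha> * z) * h)) (at z)"
      by (auto intro!: derivative_eq_intros simp: algebra_simps)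
    ultimately have "(E has_derivative (\<lambda>h. (1 + \<alpha> * z) * h - (1 + \<alpha> * z) * h)) (at z)"
      unfolding E_def by (rule has_derivative_diff)
    then show ?thesis
      by (simp add: has_derivative_at_withinI)
  qed
  then obtain c where c: "\<And>z. z \<in> ball 0 1 \<Longrightarrow> E z = c"
    using has_derivative_zero_constant[of "ball 0 1" E] by auto
  have "E 0 = 0" using f by (simp add: E_def FH0_def)
  then have "c = 0" using c[of 0] by simp
  then show thesis
    using c \<alpha>(1) by (intro that) (auto simp: E_def)
qed

lemma partials_holomorphic:
  assumes "(f has_field_derivative D) (at z)"
  shows "partial_x f z = D" "partial_y f z = D * \<i>"
proof -
  have "frechet_derivative f (at z) = (*) D"
    using assms by (simp add: has_field_derivative_def frechet_derivative_at[symmetric])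
  then show "partial_x f z = D" "partial_y f z = D * \<i>"
    by (simp_all add: partial_x_def partial_y_def)
qed

lemma extremal_in_FH0:
  assumes \<alpha>: "cmod \<alpha> = 1"
  shows "(\<lambda>z. z + \<alpha> * z\<^sup>2 / 2) \<in> FH0"
proof -
  let ?f = "\<lambda>z. z + \<alpha> * z\<^sup>2 / 2"
  have d: "(?f has_field_derivative (1 + \<alpha> * z)) (at z)" for z
    by (auto intro!: derivative_eq_intros)
  have p: "partial_x ?f = (\<lambda>z. 1 + \<alpha> * z)" "partial_y ?f = (\<lambda>z. (1 + \<alpha> * z) * \<i>)"
    using partials_holomorphic[OF d] by auto
  have dx: "(partial_x ?f has_field_derivative \<alpha>) (at z)" for z
    unfolding p by (auto intro!: derivative_eq_intros)
  have dy: "(partial_y ?f has_field_derivative (\<alpha> * \<i>)) (at z)" for z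
    unfolding p by (auto intro!: derivative_eq_intros)
  have pp: "partial_x (partial_x ?f) = (\<lambda>_. \<alpha>)" "partial_y (partial_x ?f) = (\<lambda>_. \<alpha> * \<i>)"
    "partial_x (partial_y ?f) = (\<lambda>_. \<alpha> * \<i>)" "partial_y (partial_y ?f) = (\<lambda>_. - \<alpha>)"
    using partials_holomorphic[OF dx] partials_holomorphic[OF dy] by (auto simp: mult.assoc)
  have diff: "?f differentiable (at z)" "partial_x ?f differentiable (at z)" "partial_y ?f differentiable (at z)" for z
    using d dx dy by (meson differentiableI has_field_derivative_imp_has_derivative)+
  have w: "wirtinger ?f = (\<lambda>z. 1 + \<alpha> * z)" "wirtinger_bar ?f = (\<lambda>_. 0)"
    by (auto simp: wirtinger_def wirtinger_bar_def p complex_eq_iff)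
  have "C2_on ?f (ball 0 1)"
    unfolding C2_on_def pp using diff by (intro conjI ballI continuous_intros) auto
  then have "harmonic_on ?f (ball 0 1)"
    unfolding harmonic_on_def pp by simp
  then show ?thesis
    using \<alpha> by (simp add: FH0_def w norm_mult)
qed

text \<open>
  The difference of two values is \<open>(z - w) (1 + \<alpha> (z + w) / 2)\<close>, whose second factor does not
  vanish on the disk.
\<close>

lemma extremal_inj:
  assumes \<alpha>: "cmod \<alpha> = 1"
  shows "inj_on (\<lambda>z. z + \<alpha> * z\<^sup>2 / 2) (ball 0 1)"
proof (rule inj_onI)
  fix z w :: complex
  assume zw: "z \<in> ball 0 1" "w \<in> ball 0 1" and eq: "z + \<alpha> * z\<^sup>2 / 2 = w + \<alpha> * w\<^sup>2 / 2"
  have "(z - w) * (2 + \<alpha> * (z + w)) = 2 * ((z + \<alpha> * z\<^sup>2 / 2) - (w + \<alpha> * w\<^sup>2 / 2))"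
    by (simp add: field_simps power2_eq_square)
  then have "z = w \<or> \<alpha> * (z + w) = - 2"
    using eq by (auto simp: add_eq_0_iff)
  moreover have "cmod (\<alpha> * (z + w)) < 2"
    using zw norm_triangle_ineq[of z w] \<alpha> by (simp add: norm_mult)
  ultimately show "z = w" by auto
qed

text \<open>
  For \<open>\<phi> z = \<alpha> z\<close> and \<open>\<psi> = 0\<close> the defect is identically 0, and injectivity makes the area equal
  to the integral of the Jacobian.
\<close>

lemma extremal_area:
  assumes \<alpha>: "cmod \<alpha> = 1"
  shows "area ((\<lambda>z. z + \<alpha> * z\<^sup>2 / 2) ` ball 0 1) = ennreal (3 * pi / 2)"
proof -
  let ?f = "\<lambda>z. z + \<alpha> * z\<^sup>2 / 2"
  let ?L = "\<lambda>z h. (1 + \<alpha> * z) * h + 0 * cnj h"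
  have le: "cmod (\<alpha> * z) + cmod 0 \<le> cmod z" for z :: complex
    using \<alpha> by (simp add: norm_mult)
  have hol: "(\<lambda>z. \<alpha> * z) holomorphic_on ball 0 1" "(\<lambda>z. 0) holomorphic_on ball 0 1"
    by (intro holomorphic_intros)+
  have zero: "defect (\<lambda>z. \<alpha> * z) (\<lambda>z. 0) = (\<lambda>z. 0)"
    using \<alpha> by (auto simp: defect_def norm_mult)
  have I: "(\<lambda>z. area_factor (?L z)) absolutely_integrable_on ball 0 1"
    "integral (ball 0 1) (\<lambda>z. area_factor (?L z)) = 3 * pi / 2"
    using integral_area_factor(1,3)[OF hol _ le] by (simp_all add: zero)
  have der: "(?f has_derivative ?L z) (at z within ball 0 1)" for z
    by (auto intro!: derivative_eq_intros simp: algebra_simps)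
  have one: "(\<lambda>_. 1::real) absolutely_integrable_on ?f ` ball 0 1 \<and>
      integral (?f ` ball 0 1) (\<lambda>_. 1::real) = 3 * pi / 2"
    using complex_change_of_variables[of "ball 0 1" ?f ?L "\<lambda>_. 1" "3 * pi / 2", OF _ der extremal_inj[OF \<alpha>]] I
    by simp
  then have "?f ` ball 0 1 \<in> lmeasurable"
    by (simp add: lmeasurable_iff_integrable_on set_lebesgue_integral_eq_integral(1))
  then show ?thesis
    unfolding area_def emeasure_eq_measure2[OF \<open>?f ` ball 0 1 \<in> lmeasurable\<close>]
    by (simp only: lmeasure_integral one)
qed

lemma rotation_extremal:
  "rotation \<theta> (\<lambda>w. w + w\<^sup>2 / 2) = (\<lambda>z. z + exp (\<i> * of_real \<theta>) * z\<^sup>2 / 2)"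
proof
  fix z
  define e where "e = exp (\<i> * of_real \<theta>)"
  have e: "exp (- \<i> * of_real \<theta>) * e = 1"
    by (simp add: e_def flip: exp_add)
  have distribute: "d * (e * z + (e * z)\<^sup>2 / 2) = (d * e) * z + (d * e) * (e * z\<^sup>2 / 2)" for d
    by (simp add: power2_eq_square algebra_simps)
  show "rotation \<theta> (\<lambda>w. w + w\<^sup>2 / 2) z = z + exp (\<i> * of_real \<theta>) * z\<^sup>2 / 2"
    unfolding rotation_def e_def[symmetric] distribute e by simp
qed

theorem theorem2p6:
  shows "(\<forall>f\<in>FH0. area (f ` ball 0 1) \<le> ennreal (3 * pi / 2)) \<and>
    (\<forall>\<theta>::real. rotation \<theta> (\<lambda>z. z + z\<^sup>2 / 2) \<in> FH0) \<and>
    (\<forall>f\<in>FH0. area (f ` ball 0 1) = ennreal (3 * pi / 2) \<longleftrightarrow>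
       (\<exists>\<theta>::real. \<forall>z\<in>ball 0 1. f z = rotation \<theta> (\<lambda>w. w + w\<^sup>2 / 2) z)) \<and>
    (\<forall>f\<in>FH0. area (f ` ball 0 1) = ennreal (3 * pi / 2) \<longleftrightarrow>
       (\<exists>\<theta>::real. \<forall>z\<in>ball 0 1. f z = z + exp (\<i> * of_real \<theta>) * z\<^sup>2 / 2))"
proof -
  have iff: "area (f ` ball 0 1) = ennreal (3 * pi / 2) \<longleftrightarrow>
      (\<exists>\<theta>::real. \<forall>z\<in>ball 0 1. f z = z + exp (\<i> * of_real \<theta>) * z\<^sup>2 / 2)" if f: "f \<in> FH0" for f
  proof
    assume "area (f ` ball 0 1) = ennreal (3 * pi / 2)"
    with f obtain \<alpha> where \<alpha>: "cmod \<alpha> = 1" "\<And>z. z \<in> ball 0 1 \<Longrightarrow> f z = z + \<alpha> * z\<^sup>2 / 2"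
      using FH0_area_max_imp by metis
    obtain \<theta> where "\<alpha> = exp (\<i> * of_real \<theta>)"
      using \<alpha>(1) complex_norm_eq_1_exp by metis
    with \<alpha>(2) show "\<exists>\<theta>::real. \<forall>z\<in>ball 0 1. f z = z + exp (\<i> * of_real \<theta>) * z\<^sup>2 / 2"
      by metis
  next
    assume "\<exists>\<theta>::real. \<forall>z\<in>ball 0 1. f z = z + exp (\<i> * of_real \<theta>) * z\<^sup>2 / 2"
    then obtain \<theta> :: real where "\<And>z. z \<in> ball 0 1 \<Longrightarrow> f z = z + exp (\<i> * of_real \<theta>) * z\<^sup>2 / 2"
      by blast
    then have "f ` ball 0 1 = (\<lambda>z. z + exp (\<i> * of_real \<theta>) * z\<^sup>2 / 2) ` ball 0 1"
      by (rule image_cong[OF refl])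
    then show "area (f ` ball 0 1) = ennreal (3 * pi / 2)"
      using extremal_area[of "exp (\<i> * of_real \<theta>)"] by simp
  qed
  show ?thesis
    unfolding rotation_extremal using FH0_area_le_max iff
    by (intro conjI ballI allI extremal_in_FH0) (blast | simp)+
qed

end
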